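(* For every integer $n\geq 0$, let $M_n$, $BM_n$, $U_n$, $BU_n$ denote respectively the numbers of $n$-variable Boolean functions that are monotone, balanced and monotone, unate, balanced and unate, and let $\mathrm{nd}\text{-}M_n$, $\mathrm{nd}\text{-}BM_n$, $\mathrm{nd}\text{-}U_n$, $\mathrm{nd}\text{-}BU_n$ denote the numbers of those among them that are in addition non-degenerate. Then for every $n\geq 0$: \begin{align*} \mathrm{nd}\text{-}U_n &= 2^n\cdot \mathrm{nd}\text{-}M_n,\\ \mathrm{nd}\text{-}BU_n &= 2^n\cdot \mathrm{nd}\text{-}BM_n,\\ U_n &\leq 2^n\cdot M_n,\\ BU_n &\leq 2^n\cdot BM_n. \end{align*}
   Context: An $n$-variable Boolean function is a map $f:\{0,1\}^n\to\{0,1\}$. It is monotone increasing (resp. decreasing) in the $i$-th variable if $f(x_1,\ldots,x_{i-1},0,x_{i+1},\ldots,x_n)\leq f(x_1,\ldots,x_{i-1},1,x_{i+1},\ldots,x_n)$ (resp. $\geq$) for all $x_1,\ldots,x_{i-1},x_{i+1},\ldots,x_n\in\{0,1\}$. It is unate if for each $i\in\{1,\ldots,n\}$ it is either monotone increasing or monotone decreasing in the $i$-th variable. It is monotone if it is monotone increasing in every variable. It is balanced if it takes the values $0$ and $1$ an equal number of times. It is non-degenerate on the $i$-th variable if there is $\alpha\in\{0,1\}^n$ with $f(\alpha)\neq f(\alpha\oplus \mathbf{e}_i)$, where $\mathbf{e}_i$ is the $n$-bit string with $1$ in position $i$ and $0$ elsewhere and $\oplus$ is bitwise XOR; it is non-degenerate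 if it is non-degenerate on all $n$ variables. Convention for $n=0$: there are exactly two $0$-variable Boolean functions (the constants $0$ and $1$), and both are non-degenerate, monotone (hence unate), and not balanced. *)

theory Defs
  imports Main "HOL-Library.FuncSet"
begin

(* The bits 0 and 1 are False and True, with the order False < True of type bool.
   The i-th variable is position i - 1 of the list. *)

definition cube :: "nat \<Rightarrow> bool list set" where
  "cube n = {x. length x = n}"

(* Extensional functions, so that each map on the cube is counted exactly once. *)
definition bool_funs :: "nat \<Rightarrow> (bool list \<Rightarrow> bool) set" where
  "bool_funs n = cube n \<rightarrow>\<^sub>E UNIV"

definition increasing_in :: "nat \<Rightarrow> (bool list \<Rightarrow> bool) \<Rightarrow> nat \<Rightarrow> bool" where
  "increasing_in n f i \<longleftrightarrow> (\<forall>x\<in>cube n. f (x[i := False]) \<le> f (x[i := True]))"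

definition decreasing_in :: "nat \<Rightarrow> (bool list \<Rightarrow> bool) \<Rightarrow> nat \<Rightarrow> bool" where
  "decreasing_in n f i \<longleftrightarrow> (\<forall>x\<in>cube n. f (x[i := False]) \<ge> f (x[i := True]))"

definition monotone_fun :: "nat \<Rightarrow> (bool list \<Rightarrow> bool) \<Rightarrow> bool" where
  "monotone_fun n f \<longleftrightarrow> (\<forall>i<n. increasing_in n f i)"

definition unate_fun :: "nat \<Rightarrow> (bool list \<Rightarrow> bool) \<Rightarrow> bool" where
  "unate_fun n f \<longleftrightarrow> (\<forall>i<n. increasing_in n f i \<or> decreasing_in n f i)"

definition balanced_fun :: "nat \<Rightarrow> (bool list \<Rightarrow> bool) \<Rightarrow> bool" where
  "balanced_fun n f \<longleftrightarrow> card {x \<in> cube n. f x = False} = card {x \<in> cube n. f x = True}"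

definition unit_string :: "nat \<Rightarrow> nat \<Rightarrow> bool list" where
  "unit_string n i = (replicate n False)[i := True]"

(* On bool, exclusive or is inequality. *)
definition xor_string :: "bool list \<Rightarrow> bool list \<Rightarrow> bool list" where
  "xor_string x y = map2 (\<noteq>) x y"

definition nondegenerate_on :: "nat \<Rightarrow> (bool list \<Rightarrow> bool) \<Rightarrow> nat \<Rightarrow> bool" where
  "nondegenerate_on n f i \<longleftrightarrow> (\<exists>a\<in>cube n. f a \<noteq> f (xor_string a (unit_string n i)))"

definition nondegenerate_fun :: "nat \<Rightarrow> (bool list \<Rightarrow> bool) \<Rightarrow> bool" where
  "nondegenerate_fun n f \<longleftrightarrow> (\<forall>i<n. nondegenerate_on n f i)"

definition M :: "nat \<Rightarrow> nat" where
  "M n = card {f \<in> bool_funs n. monotone_fun n f}"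

definition BM :: "nat \<Rightarrow> nat" where
  "BM n = card {f \<in> bool_funs n. balanced_fun n f \<and> monotone_fun n f}"

definition U :: "nat \<Rightarrow> nat" where
  "U n = card {f \<in> bool_funs n. unate_fun n f}"

definition BU :: "nat \<Rightarrow> nat" where
  "BU n = card {f \<in> bool_funs n. balanced_fun n f \<and> unate_fun n f}"

definition nd_M :: "nat \<Rightarrow> nat" where
  "nd_M n = card {f \<in> bool_funs n. nondegenerate_fun n f \<and> monotone_fun n f}"

definition nd_BM :: "nat \<Rightarrow> nat" where
  "nd_BM n = card {f \<in> bool_funs n. nondegenerate_fun n f \<and> balanced_fun n f \<and> monotone_fun n f}"

definition nd_U :: "nat \<Rightarrow> nat" where
  "nd_U n = card {f \<in> bool_funs n. nondegenerate_fun n f \<and> unate_fun n f}"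

definition nd_BU :: "nat \<Rightarrow> nat" where
  "nd_BU n = card {f \<in> bool_funs n. nondegenerate_fun n f \<and> balanced_fun n f \<and> unate_fun n f}"

lemma finite_cube: "finite (cube n)"
  using finite_lists_length_eq[of "UNIV :: bool set" n] by (simp add: cube_def)

lemma finite_bool_funs: "finite (bool_funs n)"
  unfolding bool_funs_def by (intro finite_PiE finite_cube) simp

lemma card_bool_funs: "card (bool_funs n) = 2 ^ (2 ^ n)"
proof -
  have "card (cube n) = 2 ^ n"
    using card_lists_length_eq[of "UNIV :: bool set" n] by (simp add: cube_def)
  then show ?thesis
    by (simp add: bool_funs_def card_PiE finite_cube)
qed

lemma zero_variables:
  "card (bool_funs 0) = 2" "nondegenerate_fun 0 f" "monotone_fun 0 f" "unate_fun 0 f"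
  "\<not> balanced_fun 0 f"
proof -
  have c: "cube 0 = {[]}"
    by (auto simp: cube_def)
  have "card {x \<in> cube 0. f x = b} = (if f [] = b then 1 else 0)" for b
  proof -
    have "{x \<in> cube 0. f x = b} = (if f [] = b then {[]} else {})"
      by (auto simp: c)
    then show ?thesis
      by simp
  qed
  from this[of False] this[of True] show "\<not> balanced_fun 0 f"
    unfolding balanced_fun_def by (cases "f []") simp_all
qed (simp_all add: card_bool_funs nondegenerate_fun_def monotone_fun_def unate_fun_def)

end

(* Translating a monotone function by s, i.e. passing from f(x) to f(x \<oplus> s), gives a unate function
   that decreases in the variables marked by s, and every unate function arises in this way.
   Translation preserves balancedness and non-degeneracy, and s and f can be recovered from the
   translate when f is non-degenerate, since then f is not decreasing in any variable. *)
theory Submission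
  imports Defs
begin

lemma card_cube: "card (cube n) = 2 ^ n"
  using card_lists_length_eq[of "UNIV :: bool set" n] by (simp add: cube_def)

lemma list_update_in_cube: "x \<in> cube n \<Longrightarrow> x[i := b] \<in> cube n"
  by (simp add: cube_def)

lemma xor_string_in_cube: "x \<in> cube n \<Longrightarrow> s \<in> cube n \<Longrightarrow> xor_string x s \<in> cube n"
  by (simp add: cube_def xor_string_def)

lemma xor_string_cancel_right:
  "x \<in> cube n \<Longrightarrow> s \<in> cube n \<Longrightarrow> xor_string (xor_string x s) s = x"
  by (rule nth_equalityI) (auto simp: cube_def xor_string_def)

lemma xor_string_list_update:
  "x \<in> cube n \<Longrightarrow> s \<in> cube n \<Longrightarrow> i < n \<Longrightarrow>
    xor_string (x[i := b]) s = (xor_string x s)[i := (b \<noteq> s ! i)]"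
  by (rule nth_equalityI) (auto simp: cube_def xor_string_def nth_list_update)

lemma xor_string_unit_string:
  "x \<in> cube n \<Longrightarrow> i < n \<Longrightarrow> xor_string x (unit_string n i) = x[i := (\<not> x ! i)]"
  by (rule nth_equalityI) (auto simp: cube_def xor_string_def unit_string_def nth_list_update)

lemma bij_betw_xor_string:
  assumes "s \<in> cube n"
  shows "bij_betw (\<lambda>x. xor_string x s) (cube n) (cube n)"
  by (rule bij_betw_byWitness[where f' = "\<lambda>x. xor_string x s"])
     (use assms in \<open>auto simp: xor_string_in_cube xor_string_cancel_right\<close>)

text \<open>The shift by \<open>s\<close> permutes the cube, so it can be absorbed into the bound
  variable. This clears the shift from monotonicity conditions on a translate.\<close>

lemma ball_cube_xor_string:
  assumes "s \<in> cube n"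
  shows "(\<forall>x\<in>cube n. P (xor_string x s)) \<longleftrightarrow> (\<forall>x\<in>cube n. P x)"
  by (metis assms xor_string_in_cube xor_string_cancel_right)

text \<open>The restriction keeps translates extensional, so that they can be counted inside
  \<open>bool_funs n\<close>.\<close>

definition translate :: "nat \<Rightarrow> bool list \<Rightarrow> (bool list \<Rightarrow> bool) \<Rightarrow> bool list \<Rightarrow> bool" where
  "translate n s f = restrict (\<lambda>x. f (xor_string x s)) (cube n)"

lemma translate_in_bool_funs: "translate n s f \<in> bool_funs n"
  by (simp add: translate_def bool_funs_def)

lemma translate_translate:
  assumes "s \<in> cube n" "f \<in> bool_funs n"
  shows "translate n s (translate n s f) = f"
proof
  fix x
  show "translate n s (translate n s f) x = f x"
    \<comment> \<open>Outside the cube both sides are \<open>undefined\<close>: the left by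
      \<open>restrict\<close>, the right because \<open>f\<close> is extensional.\<close>
    using assms by (cases "x \<in> cube n")
      (auto simp: translate_def bool_funs_def xor_string_in_cube xor_string_cancel_right
        PiE_arb[of f])
qed

text \<open>The shift negates a marked variable, which swaps the two ends of every edge in direction
  \<open>i\<close> and so reverses the inequality.\<close>

lemma increasing_in_translate:
  assumes "s \<in> cube n" "i < n"
  shows "increasing_in n (translate n s f) i \<longleftrightarrow>
    (if s ! i then decreasing_in n f i else increasing_in n f i)"
proof -
  \<comment> \<open>Moving the update past the shift turns the values \<open>False\<close> and
    \<open>True\<close> at \<open>i\<close> into \<open>s ! i\<close> and its negation.\<close>
  have "increasing_in n (translate n s f) i \<longleftrightarrow>
    (\<forall>x\<in>cube n. f ((xor_string x s)[i := s ! i]) \<le> f ((xor_string x s)[i := (\<not> s ! i)]))"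
    using assms
    by (simp add: increasing_in_def translate_def list_update_in_cube xor_string_list_update)
  also have "\<dots> \<longleftrightarrow> (\<forall>x\<in>cube n. f (x[i := s ! i]) \<le> f (x[i := (\<not> s ! i)]))"
    by (rule ball_cube_xor_string[OF assms(1)])
  finally show ?thesis
    by (auto simp: increasing_in_def decreasing_in_def)
qed

lemma decreasing_in_translate:
  assumes "s \<in> cube n" "i < n"
  shows "decreasing_in n (translate n s f) i \<longleftrightarrow>
    (if s ! i then increasing_in n f i else decreasing_in n f i)"
proof -
  have "decreasing_in n (translate n s f) i \<longleftrightarrow>
    (\<forall>x\<in>cube n. f ((xor_string x s)[i := s ! i]) \<ge> f ((xor_string x s)[i := (\<not> s ! i)]))"
    using assms
    by (simp add: decreasing_in_def translate_def list_update_in_cube xor_string_list_update)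
  also have "\<dots> \<longleftrightarrow> (\<forall>x\<in>cube n. f (x[i := s ! i]) \<ge> f (x[i := (\<not> s ! i)]))"
    by (rule ball_cube_xor_string[OF assms(1)])
  finally show ?thesis
    by (auto simp: increasing_in_def decreasing_in_def)
qed

text \<open>Increasing and decreasing together mean that \<open>f\<close> agrees at the two ends of
  every edge in direction \<open>i\<close>.\<close>

lemma nondegenerate_on_iff:
  assumes "i < n"
  shows "nondegenerate_on n f i \<longleftrightarrow> \<not> (increasing_in n f i \<and> decreasing_in n f i)"
proof
  assume "nondegenerate_on n f i"
  then obtain a where a: "a \<in> cube n" "f a \<noteq> f (a[i := (\<not> a ! i)])"
    using assms by (auto simp: nondegenerate_on_def xor_string_unit_string)
  \<comment> \<open>Now both points are updates of \<open>a\<close> at \<open>i\<close>, and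
    \<open>a ! i\<close> only decides their order.\<close>
  have "f (a[i := a ! i]) \<noteq> f (a[i := (\<not> a ! i)])"
    using a by simp
  then have "f (a[i := False]) \<noteq> f (a[i := True])"
    by (cases "a ! i") auto
  with a(1) show "\<not> (increasing_in n f i \<and> decreasing_in n f i)"
    by (auto simp: increasing_in_def decreasing_in_def)
next
  assume "\<not> (increasing_in n f i \<and> decreasing_in n f i)"
  then obtain a where a: "a \<in> cube n" "f (a[i := False]) \<noteq> f (a[i := True])"
    by (auto simp: increasing_in_def decreasing_in_def)
  have "xor_string (a[i := False]) (unit_string n i) = a[i := True]"
    using a(1) assms by (simp add: list_update_in_cube xor_string_unit_string) (simp add: cube_def)
  with a show "nondegenerate_on n f i"
    unfolding nondegenerate_on_def by (metis list_update_in_cube)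
qed

text \<open>In each variable translation at most exchanges increasing with decreasing, and
  \<open>nondegenerate_on_iff\<close> is symmetric in the two.\<close>

lemma nondegenerate_fun_translate:
  assumes "s \<in> cube n"
  shows "nondegenerate_fun n (translate n s f) \<longleftrightarrow> nondegenerate_fun n f"
  using assms
  by (auto simp: nondegenerate_fun_def nondegenerate_on_iff increasing_in_translate
      decreasing_in_translate)

text \<open>The shift by \<open>s\<close> maps each level set of the translate bijectively onto that
  of \<open>f\<close>.\<close>

lemma balanced_fun_translate:
  assumes "s \<in> cube n"
  shows "balanced_fun n (translate n s f) \<longleftrightarrow> balanced_fun n f"
proof -
  have "card {x \<in> cube n. translate n s f x = b} = card {x \<in> cube n. f x = b}" for b
  proof (rule bij_betw_same_card)
    show "bij_betw (\<lambda>x. xor_string x s) {x \<in> cube n. translate n s f x = b}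
        {x \<in> cube n. f x = b}"
      using bij_betw_Collect[OF bij_betw_xor_string[OF assms], of "\<lambda>x. f x = b"
          "\<lambda>x. translate n s f x = b"]
      by (simp add: translate_def)
  qed
  from this[of False] this[of True] show ?thesis
    unfolding balanced_fun_def by argo
qed

lemma unate_fun_translate:
  assumes "s \<in> cube n" "monotone_fun n f"
  shows "unate_fun n (translate n s f)"
  using assms
  by (auto simp: unate_fun_def monotone_fun_def increasing_in_translate decreasing_in_translate)

lemma unate_fun_imp_monotone_translate:
  assumes "unate_fun n f"
  obtains s where "s \<in> cube n" "monotone_fun n (translate n s f)"
proof
  \<comment> \<open>Exactly the variables in which \<open>f\<close> fails to increase are marked; by
    unateness \<open>f\<close> decreases there.\<close>
  let ?s = "map (\<lambda>i. \<not> increasing_in n f i) [0..<n]"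
  show s: "?s \<in> cube n"
    by (simp add: cube_def)
  show "monotone_fun n (translate n ?s f)"
    using assms by (auto simp: monotone_fun_def unate_fun_def increasing_in_translate[OF s])
qed

text \<open>Keeping the invariant property \<open>P\<close> abstract lets one argument serve all
  four counts.\<close>

lemma unate_eq_translate_monotone:
  assumes P: "\<And>s f. s \<in> cube n \<Longrightarrow> P (translate n s f) \<longleftrightarrow> P f"
  shows "{f \<in> bool_funs n. P f \<and> unate_fun n f} =
    case_prod (translate n) ` (cube n \<times> {f \<in> bool_funs n. P f \<and> monotone_fun n f})"
    (is "?U = ?T")
proof
  show "?T \<subseteq> ?U"
    by (auto simp: P translate_in_bool_funs unate_fun_translate)
  show "?U \<subseteq> ?T"
  proof
    fix f assume f: "f \<in> ?U"
    then obtain s where s: "s \<in> cube n" "monotone_fun n (translate n s f)"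
      using unate_fun_imp_monotone_translate by blast
    \<comment> \<open>Translation by \<open>s\<close> is an involution, so the monotone translate of
      \<open>f\<close> is the function part of a preimage of \<open>f\<close>.\<close>
    have "case_prod (translate n) (s, translate n s f) \<in> ?T"
      using f s by (intro imageI) (simp add: P translate_in_bool_funs)
    then show "f \<in> ?T"
      using f s(1) by (simp add: translate_translate)
  qed
qed

lemma inj_on_translate:
  "inj_on (case_prod (translate n))
    (cube n \<times> {f \<in> bool_funs n. nondegenerate_fun n f \<and> monotone_fun n f})"
proof (rule inj_onI, clarify)
  fix s t f g
  assume f: "s \<in> cube n" "f \<in> bool_funs n" "nondegenerate_fun n f" "monotone_fun n f"
    and g: "t \<in> cube n" "g \<in> bool_funs n" "nondegenerate_fun n g" "monotone_fun n g"
    and eq: "translate n s f = translate n t g"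
  \<comment> \<open>This reads the shift off the translate: if \<open>r ! i\<close> held and the
    translate were increasing in \<open>i\<close>, then \<open>h\<close> would be both increasing
    and decreasing there, against non-degeneracy.\<close>
  have shift: "increasing_in n (translate n r h) i \<longleftrightarrow> \<not> r ! i"
    if "r \<in> cube n" "nondegenerate_fun n h" "monotone_fun n h" "i < n" for r h i
    using that
    by (auto simp: increasing_in_translate nondegenerate_fun_def nondegenerate_on_iff
        monotone_fun_def)
  have "s = t"
    using f(1) g(1) shift[OF f(1,3,4)] shift[OF g(1,3,4)]
    by (intro nth_equalityI) (auto simp: cube_def eq)
  \<comment> \<open>With equal shifts, translating \<open>eq\<close> once more by \<open>s\<close>
    recovers \<open>f\<close> and \<open>g\<close>.\<close>
  then show "s = t \<and> f = g"
    using f(1,2) g(2) eq translate_translate by metis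
qed

text \<open>Different shifts may give the same translate, as for a function constant on the cube, so
  surjectivity yields only an upper bound.\<close>

lemma card_unate_le:
  assumes "\<And>s f. s \<in> cube n \<Longrightarrow> P (translate n s f) \<longleftrightarrow> P f"
  shows "card {f \<in> bool_funs n. P f \<and> unate_fun n f} \<le>
    2 ^ n * card {f \<in> bool_funs n. P f \<and> monotone_fun n f}"
proof -
  let ?A = "cube n \<times> {f \<in> bool_funs n. P f \<and> monotone_fun n f}"
  have "card (case_prod (translate n) ` ?A) \<le> card ?A"
    by (rule card_image_le) (simp add: finite_cube finite_bool_funs)
  then show ?thesis
    by (simp add: unate_eq_translate_monotone[of n P, OF assms] card_cartesian_product card_cube)
qed

text \<open>Once \<open>P\<close> forces non-degeneracy, the parametrization by shifts and monotone
  functions is also injective.\<close>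

lemma card_nondegenerate_unate:
  assumes "\<And>s f. s \<in> cube n \<Longrightarrow> P (translate n s f) \<longleftrightarrow> P f"
    and "\<And>f. P f \<Longrightarrow> nondegenerate_fun n f"
  shows "card {f \<in> bool_funs n. P f \<and> unate_fun n f} =
    2 ^ n * card {f \<in> bool_funs n. P f \<and> monotone_fun n f}"
proof -
  let ?A = "cube n \<times> {f \<in> bool_funs n. P f \<and> monotone_fun n f}"
  have "inj_on (case_prod (translate n)) ?A"
    by (rule inj_on_subset[OF inj_on_translate]) (use assms(2) in auto)
  then have "card (case_prod (translate n) ` ?A) = card ?A"
    by (rule card_image)
  then show ?thesis
    by (simp add: unate_eq_translate_monotone[of n P, OF assms(1)] card_cartesian_product card_cube)
qed

theorem proposition2:
  fixes n :: nat
  shows "nd_U n = 2 ^ n * nd_M n \<and>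
         nd_BU n = 2 ^ n * nd_BM n \<and>
         U n \<le> 2 ^ n * M n \<and>
         BU n \<le> 2 ^ n * BM n"
proof (intro conjI)
  show "nd_U n = 2 ^ n * nd_M n"
    unfolding nd_U_def nd_M_def
    by (rule card_nondegenerate_unate) (simp_all add: nondegenerate_fun_translate)
  show "nd_BU n = 2 ^ n * nd_BM n"
    using card_nondegenerate_unate[of n "\<lambda>f. nondegenerate_fun n f \<and> balanced_fun n f"]
    by (simp add: nd_BU_def nd_BM_def nondegenerate_fun_translate balanced_fun_translate)
  show "U n \<le> 2 ^ n * M n"
    using card_unate_le[of n "\<lambda>_. True"] by (simp add: U_def M_def)
  show "BU n \<le> 2 ^ n * BM n"
    unfolding BU_def BM_def by (rule card_unate_le) (rule balanced_fun_translate)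
qed

end
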